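(* Let $A$ be any fully active job scheduling algorithm. For all $\epsilon>0$ and $\delta>0$, $\mathrm{Equi}\circ A$ is a $(2+\epsilon)(1+\delta)$-speed $(2+4/\epsilon)(1+1/\delta)$-competitive algorithm for the non-clairvoyant Seq-Par batches scheduling problem; i.e. for every instance $\mathcal{B}$, the flow time of $\mathrm{Equi}\circ A$ with $(2+\epsilon)(1+\delta)$ processors is at most $(2+4/\epsilon)(1+1/\delta)\,\mathcal{B}\mathrm{OPT}_1(\mathcal{B})$.
   Context: Non-clairvoyant Seq-Par batches scheduling. An instance $\mathcal{B}=\{B_1,\dots,B_q\}$ consists of batches $B_j=\{J_{j,1},\dots,J_{j,u_j}\}$ of jobs with arrival times $a_1,\dots,a_q$. Each job $J_{j,i}$ has a sequential phase of work $w^s_{j,i}\ge0$ followed by a parallel phase of work $w^p_{j,i}\ge 0$. A schedule on $s$ processors assigns to each arrived uncompleted job an amount $\rho^t_{j,i}\ge0$ of processors (a real number) with total at most $s$ at each time. The sequential phase progresses at unit rate regardless of allocation, so it ends at time $a_j+w^s_{j,i}$; the parallel phase progresses at rate $\rho^t_{j,i}$, so $J_{j,i}$ completes at the first date $t_{j,i}$ with $\int_{a_j+w^s_{j,i}}^{t_{j,i}}\rho^t_{j,i}\,dt=w^p_{j,i}$. Batch $B_j$ completes at $t_j=\max_i t_{j,i}$; the flow time is $\sum_j(t_j-a_j)$, and $\mathcal{B}\mathrm{OPT}_s(\mathcal{B})$ is the optimal flow time with $s$ processors. The scheduler is online and non-clairvoyant: it learns batch $B_j$ at time $a_j$, knows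 nothing of the works, and learns a job's completion only when it happens. A batch (resp. job) is alive at $t$ if $a_j\le t\le t_j$ (resp. $a_j\le t\le t_{j,i}$). $\mathrm{Equi}\circ A$ with $s$ processors: with $R(t)$ the set of alive batches, each alive batch receives $s/|R(t)|$ processors, and the job scheduling algorithm $A$ decides how to split this amount among the alive jobs of the batch. $A$ is fully active if it always allots the entire amount it is given to the alive jobs of the batch. An algorithm is $s$-speed $c$-competitive if its flow time with $s$ processors is at most $c\,\mathcal{B}\mathrm{OPT}_1$ on every instance. *)

theory Defs
  imports "HOL-Analysis.Analysis"
begin

record job =
  seq_work :: real
  par_work :: real

record batch =
  arrival :: real
  jobs :: "job list"

definition is_instance :: "batch list \<Rightarrow> bool" where
  "is_instance B \<longleftrightarrow>
     (\<forall>b\<in>set B. jobs b \<noteq> [] \<and> (\<forall>J\<in>set (jobs b). 0 \<le> seq_work J \<and> 0 \<le> par_work J))"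

text \<open>An allocation \<open>\<rho>\<close> gives job \<open>i\<close> of batch \<open>j\<close> the amount \<open>\<rho> j i t\<close> of processors at date \<open>t\<close>.\<close>

type_synonym allocation = "nat \<Rightarrow> nat \<Rightarrow> real \<Rightarrow> real"

definition seq_end :: "batch list \<Rightarrow> nat \<Rightarrow> nat \<Rightarrow> real" where
  "seq_end B j i = arrival (B ! j) + seq_work (jobs (B ! j) ! i)"

text \<open>Completion dates are extended reals; a job that never completes has completion date
  \<open>Inf {} = \<infinity>\<close>.  For locally integrable \<open>\<rho>\<close> the set below is closed, so that its infimum is
  attained whenever it is nonempty.\<close>

definition job_completion :: "batch list \<Rightarrow> allocation \<Rightarrow> nat \<Rightarrow> nat \<Rightarrow> ereal" where
  "job_completion B \<rho> j i =
     Inf (ereal ` {t. seq_end B j i \<le> t \<and>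
                      integral {seq_end B j i..t} (\<rho> j i) = par_work (jobs (B ! j) ! i)})"

definition batch_completion :: "batch list \<Rightarrow> allocation \<Rightarrow> nat \<Rightarrow> ereal" where
  "batch_completion B \<rho> j = Max (job_completion B \<rho> j ` {..<length (jobs (B ! j))})"

definition flow_time :: "batch list \<Rightarrow> allocation \<Rightarrow> ereal" where
  "flow_time B \<rho> = (\<Sum>j<length B. batch_completion B \<rho> j - ereal (arrival (B ! j)))"

definition alive_batches :: "batch list \<Rightarrow> allocation \<Rightarrow> real \<Rightarrow> nat set" where
  "alive_batches B \<rho> t =
     {j. j < length B \<and> arrival (B ! j) \<le> t \<and> ereal t \<le> batch_completion B \<rho> j}"

definition alive_jobs :: "batch list \<Rightarrow> allocation \<Rightarrow> real \<Rightarrow> nat \<Rightarrow> nat set" where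
  "alive_jobs B \<rho> t j =
     {i. j < length B \<and> i < length (jobs (B ! j)) \<and>
         arrival (B ! j) \<le> t \<and> ereal t \<le> job_completion B \<rho> j i}"

definition is_schedule :: "real \<Rightarrow> batch list \<Rightarrow> allocation \<Rightarrow> bool" where
  "is_schedule s B \<rho> \<longleftrightarrow>
     (\<forall>j i a b. \<rho> j i integrable_on {a..b}) \<and>
     (\<forall>j i t. 0 \<le> \<rho> j i t) \<and>
     (\<forall>j i t. i \<notin> alive_jobs B \<rho> t j \<longrightarrow> \<rho> j i t = 0) \<and>
     (\<forall>t. (\<Sum>j<length B. \<Sum>i<length (jobs (B ! j)). \<rho> j i t) \<le> s)"

definition BOPT :: "real \<Rightarrow> batch list \<Rightarrow> ereal" where
  "BOPT s B = (INF \<rho>\<in>{\<rho>. is_schedule s B \<rho>}. flow_time B \<rho>)"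

text \<open>A \<open>view\<close> is everything a non-clairvoyant scheduler knows at date \<open>now\<close>: the arrival date and
  the number of jobs of each batch arrived so far, and the dates of the completions that took place
  before \<open>now\<close>.  (A job is still alive at its completion date, hence completions are visible
  strictly afterwards.)  Past allotments are not recorded, since for a deterministic algorithm they
  are determined by the view.\<close>

record view =
  now :: real
  arrived :: "nat \<Rightarrow> (real \<times> nat) option"
  completed :: "nat \<Rightarrow> nat \<Rightarrow> real option"

definition view_at :: "batch list \<Rightarrow> allocation \<Rightarrow> real \<Rightarrow> view" where
  "view_at B \<rho> t =
     \<lparr> now = t,
       arrived = (\<lambda>j. if j < length B \<and> arrival (B ! j) \<le> t
                      then Some (arrival (B ! j), length (jobs (B ! j))) else None),
       completed = (\<lambda>j i. if j < length B \<and> i < length (jobs (B ! j)) \<and>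
                              job_completion B \<rho> j i < ereal t
                           then Some (real_of_ereal (job_completion B \<rho> j i)) else None) \<rparr>"

text \<open>\<open>A v j x i\<close> is the share of job \<open>i\<close> when \<open>A\<close> splits the amount \<open>x\<close> given to batch \<open>j\<close>
  in the situation \<open>v\<close>.\<close>

type_synonym job_algorithm = "view \<Rightarrow> nat \<Rightarrow> real \<Rightarrow> nat \<Rightarrow> real"

definition job_scheduling_algorithm :: "job_algorithm \<Rightarrow> bool" where
  "job_scheduling_algorithm A \<longleftrightarrow>
     (\<forall>B s \<rho> t. is_instance B \<longrightarrow> is_schedule s B \<rho> \<longrightarrow>
        (\<forall>j\<in>alive_batches B \<rho> t. \<forall>x\<ge>0.
           (\<forall>i\<in>alive_jobs B \<rho> t j. 0 \<le> A (view_at B \<rho> t) j x i) \<and>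
           (\<Sum>i\<in>alive_jobs B \<rho> t j. A (view_at B \<rho> t) j x i) \<le> x))"

definition fully_active :: "job_algorithm \<Rightarrow> bool" where
  "fully_active A \<longleftrightarrow>
     (\<forall>B s \<rho> t. is_instance B \<longrightarrow> is_schedule s B \<rho> \<longrightarrow>
        (\<forall>j\<in>alive_batches B \<rho> t. \<forall>x\<ge>0.
           (\<Sum>i\<in>alive_jobs B \<rho> t j. A (view_at B \<rho> t) j x i) = x))"

text \<open>A batch scheduling algorithm is given by the schedules it produces for each number of
  processors and each instance.\<close>

type_synonym batch_algorithm = "real \<Rightarrow> batch list \<Rightarrow> allocation set"

definition Equi :: "job_algorithm \<Rightarrow> batch_algorithm" where
  "Equi A s B =
     {\<rho>. is_schedule s B \<rho> \<and>
         (\<forall>t. \<forall>j\<in>alive_batches B \<rho> t. \<forall>i\<in>alive_jobs B \<rho> t j.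
            \<rho> j i t = A (view_at B \<rho> t) j (s / real (card (alive_batches B \<rho> t))) i)}"

definition speed_competitive :: "real \<Rightarrow> real \<Rightarrow> batch_algorithm \<Rightarrow> bool" where
  "speed_competitive s c Alg \<longleftrightarrow>
     (\<forall>B. is_instance B \<longrightarrow> (\<forall>\<rho>\<in>Alg s B. flow_time B \<rho> \<le> ereal c * BOPT 1 B))"

end

theory Submission
  imports Defs
begin

text \<open>
  Fix a schedule \<open>\<tau>\<close> of finite flow time on one processor, completing batch \<open>j\<close> at date \<open>c j\<close>, and
  give batch \<open>j\<close> the constant weight \<open>r j\<close>: the number of batches that arrived no later than \<open>j\<close> and
  are not completed by the Equi schedule before \<open>c j\<close>.  After \<open>c j\<close> all jobs of batch \<open>j\<close> are in
  their parallel phase, so whatever Equi allots to the batch is useful, and it is at most the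
  parallel work of the batch, which \<open>\<tau>\<close> has carried out before \<open>c j\<close>.

  Let \<open>N\<close> be the number of batches alive at a given date, and \<open>P\<close> those of them that \<open>\<tau>\<close> has
  completed.  The weight of \<open>j \<in> P\<close> is at least its rank in \<open>P\<close> by arrival date, so Equi performs
  weighted work on \<open>P\<close> at rate at least \<open>s |P|\<^sup>2 / (2 N)\<close>, hence at least \<open>s / 2 * (N - 2 L)\<close>, where
  \<open>L\<close> is the number of batches alive under \<open>\<tau>\<close>.  On the other hand, a batch alive under \<open>\<tau>\<close> has
  weight at most \<open>N\<close>, so \<open>\<tau>\<close> performs weighted work at rate at most \<open>N\<close>.  Integrating,
  \<open>(s / 2 - 1) \<integral> N \<le> s \<integral> L\<close>.
\<close>

section \<open>Order relations between arrivals, ends of sequential phases and completions\<close>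

lemma job_completion_ge_seq_end: "ereal (seq_end B j i) \<le> job_completion B \<rho> j i"
  unfolding job_completion_def by (auto intro!: Inf_greatest)

lemma job_completion_le_batch_completion:
  assumes "i < length (jobs (B ! j))"
  shows "job_completion B \<rho> j i \<le> batch_completion B \<rho> j"
  unfolding batch_completion_def using assms by (intro Max_ge) auto

lemma seq_end_le_batch_completion:
  assumes "i < length (jobs (B ! j))"
  shows "ereal (seq_end B j i) \<le> batch_completion B \<rho> j"
  using job_completion_ge_seq_end job_completion_le_batch_completion[OF assms] by (rule order_trans)

lemma arrival_le_seq_end:
  assumes "is_instance B" "j < length B" "i < length (jobs (B ! j))"
  shows "arrival (B ! j) \<le> seq_end B j i"
  using assms unfolding is_instance_def seq_end_def by (auto simp: all_set_conv_all_nth)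

lemma arrival_le_batch_completion:
  assumes "is_instance B" "j < length B"
  shows "ereal (arrival (B ! j)) \<le> batch_completion B \<rho> j"
proof -
  have "jobs (B ! j) \<noteq> []"
    using assms unfolding is_instance_def by simp
  then have 0: "0 < length (jobs (B ! j))"
    by simp
  have "ereal (arrival (B ! j)) \<le> ereal (seq_end B j 0)"
    using arrival_le_seq_end[OF assms 0] by simp
  then show ?thesis
    using seq_end_le_batch_completion[OF 0] by (rule order_trans)
qed

section \<open>Work performed by a schedule on a single job\<close>

context
  fixes s :: real and B :: "batch list" and \<rho> :: allocation
  assumes sched: "is_schedule s B \<rho>"
begin

lemma schedule_integrable: "\<rho> j i integrable_on {a..b}"
  using sched unfolding is_schedule_def by blast

lemma schedule_nonneg: "0 \<le> \<rho> j i t"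
  using sched unfolding is_schedule_def by blast

lemma schedule_zero_after_completion: "job_completion B \<rho> j i < ereal t \<Longrightarrow> \<rho> j i t = 0"
  using sched unfolding is_schedule_def alive_jobs_def by (simp add: not_le)

lemma schedule_work_mono:
  assumes "a' \<le> a" "b \<le> b'"
  shows "integral {a..b} (\<rho> j i) \<le> integral {a'..b'} (\<rho> j i)"
  using assms by (intro integral_subset_le schedule_integrable) (auto simp: schedule_nonneg)

text \<open>The work done up to \<open>t\<close> is continuous in \<open>t\<close>, so the dates
  with exactly the required work form a closed set. Cutting this set at one of its members
  \<open>u\<close> leaves the infimum unchanged and allows continuity to be used on a bounded
  interval.\<close>

lemma job_completion_attained:
  assumes "job_completion B \<rho> j i \<noteq> \<infinity>"
  obtains t where "job_completion B \<rho> j i = ereal t" "seq_end B j i \<le> t"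
    "integral {seq_end B j i..t} (\<rho> j i) = par_work (jobs (B ! j) ! i)"
proof -
  let ?e = "seq_end B j i" and ?w = "par_work (jobs (B ! j) ! i)"
  define S where "S = {t. ?e \<le> t \<and> integral {?e..t} (\<rho> j i) = ?w}"
  have jc: "job_completion B \<rho> j i = Inf (ereal ` S)"
    unfolding job_completion_def S_def ..
  have ne: "S \<noteq> {}"
    using assms unfolding jc by (auto simp: top_ereal_def)
  then obtain u where u: "u \<in> S" by blast
  have bdd: "bdd_below S"
    unfolding S_def by (auto intro!: bdd_belowI[of _ ?e])
  let ?S = "{t \<in> {?e..u}. integral {?e..t} (\<rho> j i) = ?w}"
  have "closed ?S"
    by (intro continuous_closed_preimage_constant indefinite_integral_continuous_1
        schedule_integrable closed_atLeastAtMost)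
  moreover have "?S \<noteq> {}" "bdd_below ?S"
    using u unfolding S_def by (auto intro!: bdd_belowI[of _ ?e])
  ultimately have mem: "Inf ?S \<in> ?S"
    by (intro closed_contains_Inf)
  have "Inf S = Inf ?S"
  proof (rule cInf_eq_minimum)
    show "Inf ?S \<in> S" using mem unfolding S_def by auto
    fix t assume "t \<in> S"
    show "Inf ?S \<le> t"
    proof (cases "t \<le> u")
      case True
      with \<open>t \<in> S\<close> show ?thesis
        by (intro cInf_lower \<open>bdd_below ?S\<close>) (auto simp: S_def)
    next
      case False
      with mem show ?thesis by auto
    qed
  qed
  moreover have "Inf (ereal ` S) = ereal (Inf S)"
    using ereal_Inf'[OF bdd ne] by simp
  ultimately show ?thesis
    using that[of "Inf ?S"] mem jc by auto
qed

text \<open>An excess would, by the intermediate value theorem, be preceded by a date with exactly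
  the required work. The job would then have a finite completion date, after which it receives
  nothing, so no excess could build up.\<close>

lemma schedule_work_le_par_work:
  assumes "0 \<le> par_work (jobs (B ! j) ! i)"
  shows "integral {seq_end B j i..t} (\<rho> j i) \<le> par_work (jobs (B ! j) ! i)"
proof (rule ccontr)
  let ?e = "seq_end B j i" and ?w = "par_work (jobs (B ! j) ! i)"
  assume *: "\<not> ?thesis"
  then have et: "?e \<le> t"
    using assms by (cases "?e \<le> t") auto
  have "\<exists>x\<ge>?e. x \<le> t \<and> integral {?e..x} (\<rho> j i) = ?w"
    using * assms et
    by (intro IVT' indefinite_integral_continuous_1 schedule_integrable) auto
  then obtain x where x: "?e \<le> x" "integral {?e..x} (\<rho> j i) = ?w" by blast
  then have "job_completion B \<rho> j i \<le> ereal x"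
    unfolding job_completion_def by (auto intro!: Inf_lower)
  then have "job_completion B \<rho> j i \<noteq> \<infinity>" by auto
  then obtain u where u: "job_completion B \<rho> j i = ereal u" "?e \<le> u"
    "integral {?e..u} (\<rho> j i) = ?w"
    by (rule job_completion_attained)
  have ut: "u \<le> t"
    using * u schedule_work_mono[of ?e ?e t u j i] by (cases "u \<le> t") auto
  \<comment> \<open>A job is still alive at its completion date \<open>u\<close> and may hold
    processors there; this single point does not affect the integral.\<close>
  have "integral {u..t} (\<rho> j i) = integral {u..t} (\<lambda>_. 0)"
    using u(1) by (intro integral_spike[of "{u}"]) (auto simp: schedule_zero_after_completion)
  then have "integral {?e..t} (\<rho> j i) = ?w"
    using Henstock_Kurzweil_Integration.integral_combine[OF u(2) ut schedule_integrable, of j i] u(3) by simp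
  with * show False by simp
qed

lemma schedule_work_ge_par_work:
  assumes "is_instance B" "j < length B" "i < length (jobs (B ! j))"
    and "batch_completion B \<rho> j \<le> ereal c" "a \<le> arrival (B ! j)"
  shows "par_work (jobs (B ! j) ! i) \<le> integral {a..c} (\<rho> j i)"
proof -
  have le: "job_completion B \<rho> j i \<le> ereal c"
    using job_completion_le_batch_completion[OF assms(3)] assms(4) by (rule order_trans)
  then have "job_completion B \<rho> j i \<noteq> \<infinity>" by auto
  then obtain t where t: "job_completion B \<rho> j i = ereal t" "seq_end B j i \<le> t"
    "integral {seq_end B j i..t} (\<rho> j i) = par_work (jobs (B ! j) ! i)"
    by (rule job_completion_attained)
  then show ?thesis
    using le arrival_le_seq_end[OF assms(1-3)] assms(5)
      schedule_work_mono[of a "seq_end B j i" t c j i] by simp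
qed

end

section \<open>Shares under Equi and the comparison of weighted work\<close>

lemma equi_batch_share:
  assumes "is_instance B" "fully_active A" "\<rho> \<in> Equi A s B" "0 \<le> s" "j \<in> alive_batches B \<rho> t"
  shows "(\<Sum>i<length (jobs (B ! j)). \<rho> j i t) = s / real (card (alive_batches B \<rho> t))"
proof -
  let ?x = "s / real (card (alive_batches B \<rho> t))"
  have sched: "is_schedule s B \<rho>"
    using assms(3) unfolding Equi_def by blast
  have "(\<Sum>i<length (jobs (B ! j)). \<rho> j i t) = (\<Sum>i\<in>alive_jobs B \<rho> t j. \<rho> j i t)"
    using sched unfolding is_schedule_def
    by (intro sum.mono_neutral_right) (auto simp: alive_jobs_def)
  also have "\<dots> = (\<Sum>i\<in>alive_jobs B \<rho> t j. A (view_at B \<rho> t) j ?x i)"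
    using assms(3,5) unfolding Equi_def by (intro sum.cong) auto
  also have "\<dots> = ?x"
    using assms sched unfolding fully_active_def by (simp add: zero_le_divide_iff)
  finally show ?thesis .
qed

text \<open>Of two elements of \<open>P\<close>, one has an \<open>f\<close>-value at most that of
  the other, so \<open>?Q\<close> and its mirror image cover \<open>P \<times> P\<close>. Ties are
  counted twice, which only helps.\<close>

lemma card_square_le_sum_rank:
  fixes f :: "'a \<Rightarrow> 'b::linorder"
  assumes "finite P"
  shows "(card P)\<^sup>2 \<le> 2 * (\<Sum>j\<in>P. card {k \<in> P. f k \<le> f j})"
proof -
  let ?Q = "SIGMA j:P. {k \<in> P. f k \<le> f j}"
  have "card (P \<times> P) \<le> card (?Q \<union> prod.swap ` ?Q)"
    using assms by (intro card_mono) (auto simp: image_iff)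
  also have "\<dots> \<le> card ?Q + card (prod.swap ` ?Q)"
    by (rule card_Un_le)
  also have "\<dots> \<le> card ?Q + card ?Q"
    using assms by (intro add_left_mono card_image_le) auto
  finally show ?thesis
    using assms by (simp add: card_cartesian_product power2_eq_square card_SigmaI)
qed

text \<open>Serves to write a flow time as the integral of the number of alive batches.\<close>

lemma has_integral_card:
  fixes Q :: "nat \<Rightarrow> real \<Rightarrow> bool"
  assumes "\<And>j. j < n \<Longrightarrow> ((\<lambda>t. if Q j t then 1 else 0) has_integral d j) X"
  shows "((\<lambda>t. real (card {j. j < n \<and> Q j t})) has_integral (\<Sum>j<n. d j)) X"
proof -
  have "real (card {j. j < n \<and> Q j t}) = (\<Sum>j<n. if Q j t then 1 else 0)" for t
    by (subst sum.If_cases) (auto intro!: arg_cong[where f = card])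
  then show ?thesis
    using assms by (auto intro!: has_integral_sum)
qed

lemma has_integral_indicator_Icc:
  fixes a b :: real
  assumes "l \<le> a" "a \<le> b" "b \<le> u" "\<And>t. l \<le> t \<Longrightarrow> t \<le> u \<Longrightarrow> Q t \<longleftrightarrow> a \<le> t \<and> t \<le> b"
  shows "((\<lambda>t. if Q t then 1 else 0 :: real) has_integral (b - a)) {l..u}"
proof -
  have "((\<lambda>t. if t \<in> {a..b} then 1 else 0 :: real) has_integral (b - a)) {l..u}"
    using assms has_integral_const_real[of "1::real" a b] by (subst has_integral_restrict) auto
  then show ?thesis
    by (rule has_integral_eq[rotated]) (use assms(4) in auto)
qed

text \<open>The dates \<open>d j\<close> are the completion dates under Equi truncated at a horizon \<open>T\<close>, as it is not
  known beforehand that Equi completes every batch.\<close>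

lemma equi_truncated_flow_bound:
  assumes inst: "is_instance B" and fa: "fully_active A" and equi: "\<rho> \<in> Equi A s B" and "0 \<le> s"
    and sched: "is_schedule 1 B \<tau>"
    and c: "\<And>j. j < length B \<Longrightarrow> batch_completion B \<tau> j = ereal (c j)"
    and cT: "\<And>j. j < length B \<Longrightarrow> c j \<le> T"
    and d: "\<And>j. j < length B \<Longrightarrow> ereal (d j) = min (ereal T) (batch_completion B \<rho> j)"
  shows "(s / 2 - 1) * (\<Sum>j<length B. d j - arrival (B ! j))
    \<le> s * (\<Sum>j<length B. c j - arrival (B ! j))"
proof -
  let ?n = "length B" and ?a = "\<lambda>j. arrival (B ! j)" and ?u = "\<lambda>j. length (jobs (B ! j))"
  \<comment> \<open>The earliest arrival; including \<open>T\<close> keeps \<open>Min\<close>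
    meaningful for an empty instance.\<close>
  define T0 where "T0 = Min (insert T (?a ` {..<?n}))"
  have T0: "T0 \<le> ?a j" if "j < ?n" for j
    unfolding T0_def using that by (intro Min_le) auto
  have ac: "?a j \<le> c j" if "j < ?n" for j
    using arrival_le_batch_completion[OF inst that, of \<tau>] c[OF that] by simp
  have ad: "?a j \<le> d j" and dT: "d j \<le> T" if "j < ?n" for j
  proof -
    have "ereal (?a j) \<le> ereal (d j)"
      unfolding d[OF that] using arrival_le_batch_completion[OF inst that] ac[OF that] cT[OF that]
      by simp
    then show "?a j \<le> d j" by simp
    have "ereal (d j) \<le> ereal T" unfolding d[OF that] by simp
    then show "d j \<le> T" by simp
  qed
  have sched\<rho>: "is_schedule s B \<rho>"
    using equi unfolding Equi_def by blast

  define N where "N t = real (card (alive_batches B \<rho> t))" for t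
  define L where "L t = real (card {j. j < ?n \<and> ?a j \<le> t \<and> t \<le> c j})" for t
  define r where
    "r j = real (card {k. k < ?n \<and> ?a k \<le> ?a j \<and> ereal (c j) \<le> batch_completion B \<rho> k})" for j
  define \<sigma> where "\<sigma> j t = (\<Sum>i<?u j. \<rho> j i t)" for j t
  define \<pi> where "\<pi> j t = (\<Sum>i<?u j. \<tau> j i t)" for j t
  have \<sigma>_nonneg: "0 \<le> \<sigma> j t" and \<pi>_nonneg: "0 \<le> \<pi> j t" for j t
    unfolding \<sigma>_def \<pi>_def
    by (simp_all add: sum_nonneg schedule_nonneg[OF sched\<rho>] schedule_nonneg[OF sched])
  have \<sigma>_int: "\<sigma> j integrable_on {a..b}" and \<pi>_int: "\<pi> j integrable_on {a..b}" for j a b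
    unfolding \<sigma>_def \<pi>_def
    by (auto intro!: integrable_sum schedule_integrable[OF sched\<rho>] schedule_integrable[OF sched])

  have N_int: "(N has_integral (\<Sum>j<?n. d j - ?a j)) {T0..T}"
    unfolding N_def alive_batches_def
  proof (rule has_integral_card, rule has_integral_indicator_Icc[OF T0 ad dT])
    fix j t assume "j < ?n" "T0 \<le> t" "t \<le> T"
    \<comment> \<open>Up to the horizon, truncation does not change which batches are alive.\<close>
    have "t \<le> d j \<longleftrightarrow> ereal t \<le> ereal (d j)" by simp
    then show "?a j \<le> t \<and> ereal t \<le> batch_completion B \<rho> j \<longleftrightarrow> ?a j \<le> t \<and> t \<le> d j"
      unfolding d[OF \<open>j < ?n\<close>] using \<open>t \<le> T\<close> by simp
  qed
  have L_int: "(L has_integral (\<Sum>j<?n. c j - ?a j)) {T0..T}"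
    unfolding L_def by (rule has_integral_card, rule has_integral_indicator_Icc[OF T0 ac cT]) auto

  \<comment> \<open>The rate of weighted work of Equi, counted for each batch only after its
    completion under \<open>\<tau>\<close>.\<close>
  define G where "G t = (\<Sum>j<?n. r j * (if t \<in> {c j..T} then \<sigma> j t else 0))" for t
  have G_int: "(G has_integral (\<Sum>j<?n. r j * integral {c j..T} (\<sigma> j))) {T0..T}"
    unfolding G_def
  proof (intro has_integral_sum has_integral_mult_right)
    fix j assume "j \<in> {..<?n}"
    then have "{c j..T} \<subseteq> {T0..T}"
      using T0[of j] ac[of j] by auto
    then show "((\<lambda>t. if t \<in> {c j..T} then \<sigma> j t else 0) has_integral integral {c j..T} (\<sigma> j)) {T0..T}"
      by (subst has_integral_restrict) (auto intro: integrable_integral \<sigma>_int)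
  qed auto
  have "s / 2 * (N t - 2 * L t) \<le> G t" if t: "t \<in> {T0..T}" for t
  proof -
    define R where "R = alive_batches B \<rho> t"
    \<comment> \<open>The inequality is strict because a batch with \<open>c j = t\<close> is
      already counted in \<open>L t\<close>.\<close>
    define P where "P = {j \<in> R. c j < t}"
    have R: "R \<subseteq> {..<?n}" and P: "P \<subseteq> {..<?n}" and fin: "finite R" "finite P"
      unfolding R_def P_def alive_batches_def by auto
    have N: "N t = real (card R)"
      unfolding N_def R_def ..
    have "card R \<le> card (P \<union> {j. j < ?n \<and> ?a j \<le> t \<and> t \<le> c j})"
      using fin by (intro card_mono) (auto simp: P_def R_def alive_batches_def)
    also have "\<dots> \<le> card P + card {j. j < ?n \<and> ?a j \<le> t \<and> t \<le> c j}"
      by (rule card_Un_le)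
    finally have NL: "N t \<le> real (card P) + L t"
      unfolding N L_def by linarith
    \<comment> \<open>Squaring \<open>N - L \<le> |P|\<close> and dropping the term
      \<open>L^2\<close> gives the claim; if \<open>L > N\<close> the left side is not
      positive.\<close>
    have sq: "N t * (N t - 2 * L t) \<le> (real (card P))\<^sup>2"
    proof (cases "L t \<le> N t")
      case True
      then have "(N t - L t)\<^sup>2 \<le> (real (card P))\<^sup>2"
        using NL by (intro power_mono) auto
      moreover have "(N t - L t)\<^sup>2 = N t * (N t - 2 * L t) + (L t)\<^sup>2"
        by (simp add: power2_eq_square algebra_simps)
      ultimately show ?thesis
        using zero_le_power2[of "L t"] by linarith
    next
      case False
      moreover have "0 \<le> N t" "0 \<le> L t" unfolding N_def L_def by auto
      ultimately have "N t * (N t - 2 * L t) \<le> 0"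
        by (intro mult_nonneg_nonpos) auto
      then show ?thesis
        using zero_le_power2[of "real (card P)"] by linarith
    qed
    \<comment> \<open>Every batch of \<open>P\<close> is alive under Equi at \<open>t\<close>, which
      is later than \<open>c j\<close>, so those that arrived no later than \<open>j\<close> are
      counted in \<open>r j\<close>.\<close>
    have rank: "real (card {k \<in> P. ?a k \<le> ?a j}) \<le> r j" if "j \<in> P" for j
      unfolding r_def of_nat_le_iff
    proof (rule card_mono)
      have "ereal (c j) \<le> batch_completion B \<rho> k" if "ereal t \<le> batch_completion B \<rho> k" for k
        using that \<open>j \<in> P\<close> unfolding P_def by (intro order_trans[OF _ that]) simp
      then show "{k \<in> P. ?a k \<le> ?a j}
          \<subseteq> {k. k < ?n \<and> ?a k \<le> ?a j \<and> ereal (c j) \<le> batch_completion B \<rho> k}"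
        unfolding P_def R_def alive_batches_def by auto
    qed auto
    have "(real (card P))\<^sup>2 \<le> 2 * (\<Sum>j\<in>P. real (card {k \<in> P. ?a k \<le> ?a j}))"
      using of_nat_mono[OF card_square_le_sum_rank[OF fin(2), of ?a], where 'a = real] by simp
    also have "\<dots> \<le> 2 * (\<Sum>j\<in>P. r j)"
      by (intro mult_left_mono sum_mono rank) auto
    finally have "N t * (N t - 2 * L t) \<le> 2 * (\<Sum>j\<in>P. r j)"
      using sq by linarith
    then have "s / 2 * (N t - 2 * L t) \<le> (\<Sum>j\<in>P. r j) * (s / N t)"
    \<comment> \<open>For \<open>N t = 0\<close> the quotient \<open>s / N t\<close> is 0 by
      convention, and the left side is \<open>- s * L t\<close>.\<close>
    proof (cases "N t = 0")
      case True
      moreover have "0 \<le> s * L t" unfolding L_def using \<open>0 \<le> s\<close> by simp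
      ultimately show ?thesis by (simp add: algebra_simps)
    next
      case False
      then have "0 < N t" unfolding N_def by simp
      have "s / 2 * (N t - 2 * L t) = N t * (N t - 2 * L t) * (s / (2 * N t))"
        using \<open>0 < N t\<close> by (simp add: field_simps)
      also have "\<dots> \<le> 2 * (\<Sum>j\<in>P. r j) * (s / (2 * N t))"
        using \<open>0 < N t\<close> \<open>0 \<le> s\<close> \<open>N t * (N t - 2 * L t) \<le> 2 * (\<Sum>j\<in>P. r j)\<close>
        by (intro mult_right_mono) auto
      finally show ?thesis by simp
    qed
    also have "\<dots> = (\<Sum>j\<in>P. r j * (if t \<in> {c j..T} then \<sigma> j t else 0))"
      unfolding sum_distrib_right
    proof (rule sum.cong)
      fix j assume j: "j \<in> P"
      then have "\<sigma> j t = s / N t"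
        unfolding \<sigma>_def N_def using equi_batch_share[OF inst fa equi \<open>0 \<le> s\<close>]
        by (simp add: P_def R_def)
      then show "r j * (s / N t) = r j * (if t \<in> {c j..T} then \<sigma> j t else 0)"
        using j t unfolding P_def by simp
    qed simp
    also have "\<dots> \<le> G t"
      unfolding G_def using P by (intro sum_mono2) (auto simp: r_def \<sigma>_nonneg)
    finally show ?thesis .
  qed
  then have "s / 2 * ((\<Sum>j<?n. d j - ?a j) - 2 * (\<Sum>j<?n. c j - ?a j))
      \<le> (\<Sum>j<?n. r j * integral {c j..T} (\<sigma> j))"
    by (intro has_integral_le[OF has_integral_mult_right[OF has_integral_diff[OF N_int
              has_integral_mult_right[OF L_int]]] G_int])
  \<comment> \<open>The parallel work of each job separates the two sides: it bounds what Equi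
    allots to the job after \<open>c j\<close>, and \<open>\<tau>\<close> must have allotted at
    least that much.\<close>
  also have "\<dots> \<le> (\<Sum>j<?n. r j * integral {T0..T} (\<pi> j))"
  proof (intro sum_mono mult_left_mono)
    fix j assume "j \<in> {..<?n}"
    then have j: "j < ?n" by simp
    have "integral {c j..T} (\<rho> j i) \<le> integral {T0..T} (\<tau> j i)" if i: "i < ?u j" for i
    proof -
      have "seq_end B j i \<le> c j"
        using seq_end_le_batch_completion[OF i, of \<tau>] c[OF j] by simp
      then have "integral {c j..T} (\<rho> j i) \<le> integral {seq_end B j i..T} (\<rho> j i)"
        by (intro schedule_work_mono[OF sched\<rho>]) auto
      also have "\<dots> \<le> par_work (jobs (B ! j) ! i)"
        using inst i j by (intro schedule_work_le_par_work[OF sched\<rho>]) (auto simp: is_instance_def all_set_conv_all_nth)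
      also have "\<dots> \<le> integral {T0..T} (\<tau> j i)"
        using cT[OF j] c[OF j] T0[OF j]
        by (intro schedule_work_ge_par_work[OF sched inst j i]) auto
      finally show ?thesis .
    qed
    then show "integral {c j..T} (\<sigma> j) \<le> integral {T0..T} (\<pi> j)"
      unfolding \<sigma>_def \<pi>_def
      by (subst (1 2) integral_sum)
        (auto intro: sum_mono schedule_integrable[OF sched\<rho>] schedule_integrable[OF sched])
  qed (simp add: r_def)
  also have "\<dots> \<le> (\<Sum>j<?n. d j - ?a j)"
  proof (rule has_integral_le[OF _ N_int])
    show "((\<lambda>t. \<Sum>j<?n. r j * \<pi> j t) has_integral (\<Sum>j<?n. r j * integral {T0..T} (\<pi> j))) {T0..T}"
      by (intro has_integral_sum has_integral_mult_right integrable_integral \<pi>_int) auto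
    fix t
    have "r j * \<pi> j t \<le> N t * \<pi> j t" if j: "j < ?n" for j
    proof (cases "?a j \<le> t \<and> t \<le> c j")
      case True
      \<comment> \<open>A batch counted in \<open>r j\<close> arrived by \<open>?a j \<le> t\<close>
        and is not completed by Equi before \<open>c j \<ge> t\<close>, so it is alive at
        \<open>t\<close>.\<close>
      have "ereal t \<le> batch_completion B \<rho> k" if "ereal (c j) \<le> batch_completion B \<rho> k" for k
        using True that by (metis ereal_less_eq(3) order_trans)
      then have "r j \<le> N t"
        unfolding r_def N_def of_nat_le_iff using True
        by (intro card_mono) (auto simp: alive_batches_def)
      then show ?thesis
        by (intro mult_right_mono \<pi>_nonneg)
    next
      case False
      have "i \<notin> alive_jobs B \<tau> t j" if "i < ?u j" for i
      proof
        assume "i \<in> alive_jobs B \<tau> t j"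
        then have "?a j \<le> t" "ereal t \<le> job_completion B \<tau> j i"
          unfolding alive_jobs_def by auto
        moreover have "job_completion B \<tau> j i \<le> ereal (c j)"
          using job_completion_le_batch_completion[OF that, of \<tau>] c[OF j] by simp
        ultimately show False
          using False by (metis ereal_less_eq(3) order_trans)
      qed
      then have "\<pi> j t = 0"
        unfolding \<pi>_def using sched by (auto simp: is_schedule_def)
      then show ?thesis by simp
    qed
    then have "(\<Sum>j<?n. r j * \<pi> j t) \<le> N t * (\<Sum>j<?n. \<pi> j t)"
      unfolding sum_distrib_left by (intro sum_mono) auto
    also have "\<dots> \<le> N t * 1"
      using sched unfolding \<pi>_def N_def is_schedule_def by (intro mult_left_mono) auto
    finally show "(\<Sum>j<?n. r j * \<pi> j t) \<le> N t" by simp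
  qed
  finally show ?thesis
    by (simp add: algebra_simps)
qed

section \<open>Removing the horizon and deriving the competitive ratio\<close>

lemma flow_time_finite:
  assumes "\<And>j. j < length B \<Longrightarrow> batch_completion B \<rho> j = ereal (c j)"
  shows "flow_time B \<rho> = ereal (\<Sum>j<length B. c j - arrival (B ! j))"
  unfolding flow_time_def using assms by (simp flip: sum_ereal)

lemma batch_completion_finite_if_flow_time_finite:
  assumes inst: "is_instance B" and fin: "flow_time B \<rho> \<noteq> \<infinity>" and j: "j < length B"
  shows "batch_completion B \<rho> j = ereal (real_of_ereal (batch_completion B \<rho> j))"
proof -
  have "batch_completion B \<rho> j - ereal (arrival (B ! j)) \<noteq> \<infinity>"
    using fin j unfolding flow_time_def by (auto simp: sum_Pinfty)
  then have "batch_completion B \<rho> j \<noteq> \<infinity>" by auto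
  moreover have "batch_completion B \<rho> j \<noteq> -\<infinity>"
    using arrival_le_batch_completion[OF inst j, of \<rho>] by auto
  ultimately show ?thesis
    by (cases "batch_completion B \<rho> j") auto
qed

text \<open>The factor comes from dividing the truncated bound by \<open>s / 2 - 1\<close>. Since
  the bound does not depend on the horizon, Equi completes every batch, and a late enough horizon
  truncates nothing.\<close>

lemma equi_flow_time_le:
  assumes inst: "is_instance B" and fa: "fully_active A" and equi: "\<rho> \<in> Equi A s B" and s: "2 < s"
    and sched: "is_schedule 1 B \<tau>"
  shows "flow_time B \<rho> \<le> ereal (2 * s / (s - 2)) * flow_time B \<tau>"
proof (cases "flow_time B \<tau> = \<infinity>")
  case True
  then show ?thesis using s by simp
next
  case False
  let ?n = "length B" and ?a = "\<lambda>j. arrival (B ! j)" and ?C = "2 * s / (s - 2)"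
  define c where "c j = real_of_ereal (batch_completion B \<tau> j)" for j
  have c: "batch_completion B \<tau> j = ereal (c j)" if "j < ?n" for j
    unfolding c_def by (rule batch_completion_finite_if_flow_time_finite[OF inst False that])
  define F where "F = (\<Sum>j<?n. c j - ?a j)"
  define d where "d T j = real_of_ereal (min (ereal T) (batch_completion B \<rho> j))" for T j
  have d: "ereal (d T j) = min (ereal T) (batch_completion B \<rho> j)" if "j < ?n" for T j
    using arrival_le_batch_completion[OF inst that, of \<rho>] unfolding d_def
    by (cases "batch_completion B \<rho> j") (auto simp: min_def)
  have bound: "(\<Sum>j<?n. d T j - ?a j) \<le> ?C * F" if "\<And>j. j < ?n \<Longrightarrow> c j \<le> T" for T
  proof -
    have "(s / 2 - 1) * (\<Sum>j<?n. d T j - ?a j) \<le> s * F"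
      unfolding F_def using s
      by (intro equi_truncated_flow_bound[OF inst fa equi _ sched c that d]) auto
    then show ?thesis
      using s by (simp add: field_simps)
  qed
  define T1 where "T1 = Max (insert 0 (c ` {..<?n}))"
  have T1: "c j \<le> T1" if "j < ?n" for j
    unfolding T1_def using that by (intro Max_ge) auto
  have fin: "batch_completion B \<rho> j \<noteq> \<infinity>" if j: "j < ?n" for j
  proof
    assume inf: "batch_completion B \<rho> j = \<infinity>"
    \<comment> \<open>At this horizon an uncompleted batch \<open>j\<close> alone contributes at
      least \<open>?C * F + 1\<close> to the truncated flow time.\<close>
    define T where "T = max T1 (?a j + ?C * F + 1)"
    have cT: "c k \<le> T" if "k < ?n" for k
      using T1[OF that] unfolding T_def by simp
    have "0 \<le> d T k - ?a k" if "k < ?n" for k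
    proof -
      have "?a k \<le> T"
        using arrival_le_batch_completion[OF inst that, of \<tau>] c[OF that] cT[OF that] by simp
      then have "ereal (?a k) \<le> ereal (d T k)"
        unfolding d[OF that] using arrival_le_batch_completion[OF inst that, of \<rho>] by simp
      then show ?thesis by simp
    qed
    then have "d T j - ?a j \<le> (\<Sum>k<?n. d T k - ?a k)"
      using j by (intro member_le_sum) auto
    moreover have "d T j = T"
      using d[OF j, of T] inf by simp
    ultimately show False
      using bound[OF cT] unfolding T_def by simp
  qed
  define e where "e j = real_of_ereal (batch_completion B \<rho> j)" for j
  have e: "batch_completion B \<rho> j = ereal (e j)" if "j < ?n" for j
    using fin[OF that] arrival_le_batch_completion[OF inst that, of \<rho>] unfolding e_def
    by (cases "batch_completion B \<rho> j") auto
  define T where "T = Max (insert T1 (e ` {..<?n}))"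
  have "T1 \<le> T" and eT: "e j \<le> T" if "j < ?n" for j
    unfolding T_def using that by (auto intro!: Max_ge)
  have "d T j = e j" if "j < ?n" for j
    using d[OF that, of T] e[OF that] eT[OF that] by (simp add: min_def split: if_splits)
  then have "(\<Sum>j<?n. e j - ?a j) = (\<Sum>j<?n. d T j - ?a j)"
    by simp
  also have "\<dots> \<le> ?C * F"
    using T1 \<open>\<And>j. j < ?n \<Longrightarrow> T1 \<le> T\<close> by (intro bound) (meson order_trans)
  finally have "(\<Sum>j<?n. e j - ?a j) \<le> ?C * F" .
  moreover have "flow_time B \<rho> = ereal (\<Sum>j<?n. e j - ?a j)" "flow_time B \<tau> = ereal F"
    unfolding F_def using c e by (simp_all add: flow_time_finite)
  ultimately show ?thesis by simp
qed

theorem theorem3: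
  fixes A :: job_algorithm and \<epsilon> \<delta> :: real
  assumes "job_scheduling_algorithm A" and "fully_active A"
    and "\<epsilon> > 0" and "\<delta> > 0"
  shows "speed_competitive ((2 + \<epsilon>) * (1 + \<delta>)) ((2 + 4 / \<epsilon>) * (1 + 1 / \<delta>)) (Equi A)"
  unfolding speed_competitive_def
proof (intro allI impI ballI)
  let ?s = "(2 + \<epsilon>) * (1 + \<delta>)" and ?C = "(2 + 4 / \<epsilon>) * (1 + 1 / \<delta>)"
  fix B \<rho> assume inst: "is_instance B" and equi: "\<rho> \<in> Equi A ?s B"
  have "0 \<le> (2 + \<epsilon>) * \<delta>"
    using assms by simp
  then have s: "\<epsilon> \<le> ?s - 2"
    by (simp add: algebra_simps)
  then have s2: "0 < ?s - 2"
    using \<open>\<epsilon> > 0\<close> by linarith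
  \<comment> \<open>Written this way the ratio decreases in the speed, so
    \<open>?s - 2 \<ge> \<epsilon>\<close> already gives \<open>2 + 4 / \<epsilon>\<close>; the
    factor \<open>1 + 1 / \<delta>\<close> only enlarges it.\<close>
  have "2 * ?s / (?s - 2) = 2 + 4 / (?s - 2)"
    using s2 by (simp add: field_simps)
  also have "\<dots> \<le> 2 + 4 / \<epsilon>"
    by (intro add_left_mono divide_left_mono s mult_pos_pos s2 \<open>\<epsilon> > 0\<close>) auto
  also have "\<dots> \<le> ?C"
    using assms mult_left_mono[of 1 "1 + 1 / \<delta>" "2 + 4 / \<epsilon>"] by simp
  finally have C: "2 * ?s / (?s - 2) \<le> ?C" .
  have "0 < ?C"
    using assms by (intro mult_pos_pos add_pos_pos) auto
  \<comment> \<open>Dividing by the positive constant turns the claim into a lower bound for an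
    infimum, which can be checked for each schedule.\<close>
  have "flow_time B \<rho> / ereal ?C \<le> BOPT 1 B"
    unfolding BOPT_def
  proof (rule INF_greatest)
    fix \<tau> assume "\<tau> \<in> {\<tau>. is_schedule 1 B \<tau>}"
    then have "flow_time B \<rho> \<le> ereal (2 * ?s / (?s - 2)) * flow_time B \<tau>"
      using s2 by (intro equi_flow_time_le[OF inst assms(2) equi]) auto
    also have "\<dots> \<le> ereal ?C * flow_time B \<tau>"
    proof (rule ereal_mult_right_mono)
      show "0 \<le> flow_time B \<tau>"
        unfolding flow_time_def using arrival_le_batch_completion[OF inst]
        by (intro sum_nonneg) (auto simp: ereal_diff_positive)
    qed (use C in simp)
    finally show "flow_time B \<rho> / ereal ?C \<le> flow_time B \<tau>"
      using \<open>0 < ?C\<close> by (intro ereal_divide_le_pos[THEN iffD2]) auto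
  qed
  then show "flow_time B \<rho> \<le> ereal ?C * BOPT 1 B"
    using \<open>0 < ?C\<close> by (subst (asm) ereal_divide_le_pos) auto
qed

end
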